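(* Let $d,s_1,\ldots,s_d$ be positive integers, let $\boldsymbol n_1,\ldots,\boldsymbol n_d$ be positive multi-indices, and let $a_i:[0,1]^{|\boldsymbol n_i|}\to\mathbb C$ for every $i=1,\ldots,d$. Then $$D_{\boldsymbol n_1}(a_1I_{s_1})\otimes\cdots\otimes D_{\boldsymbol n_d}(a_dI_{s_d})=\Pi_{N(\boldsymbol n_1),\ldots,N(\boldsymbol n_d)}^{s_1,\ldots,s_d}\,D_{\boldsymbol n}\bigl((a_1\otimes\cdots\otimes a_d)I_{s_1\cdots s_d}\bigr)\,\bigl(\Pi_{N(\boldsymbol n_1),\ldots,N(\boldsymbol n_d)}^{s_1,\ldots,s_d}\bigr)^T,$$ where $\boldsymbol n=(\boldsymbol n_1,\ldots,\boldsymbol n_d)$. In particular, if $s_1=\cdots=s_d=1$, then $$D_{\boldsymbol n_1}(a_1)\otimes\cdots\otimes D_{\boldsymbol n_d}(a_d)=D_{\boldsymbol n}(a_1\otimes\cdots\otimes a_d).$$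
   Context: **Multi-indices.** A multi-index of length $q$ (a $q$-index) is a vector $\boldsymbol i=(i_1,\ldots,i_q)\in\mathbb Z^q$, with length $|\boldsymbol i|=q$; it is positive if all its components are positive. $\boldsymbol 1$ is the vector of all ones and $N(\boldsymbol m)=m_1\cdots m_q$. Operations such as $\boldsymbol i/\boldsymbol n=(i_1/n_1,\ldots,i_q/n_q)$ are componentwise. Index ranges $\{\boldsymbol 1,\ldots,\boldsymbol n\}=\{\boldsymbol i:\boldsymbol 1\le\boldsymbol i\le\boldsymbol n\}$ are ordered lexicographically, last component varying fastest. $(\boldsymbol n_1,\ldots,\boldsymbol n_d)$ denotes concatenation. **Diagonal sampling matrices.** For $\boldsymbol n\in\mathbb N^q$ ($\mathbb N=\{1,2,\ldots\}$) and $a:[0,1]^q\to\mathbb C^{s\times t}$, $D_{\boldsymbol n}(a)={\rm diag}_{\boldsymbol i=\boldsymbol 1,\ldots,\boldsymbol n}\,a(\boldsymbol i/\boldsymbol n)$ is the block diagonal matrix of size $N(\boldsymbol n)s\times N(\boldsymbol n)t$ with blocks in lexicographic order. **Tensor products.** $X\otimes Y=[x_{ij}Y]_{i,j}$ is the Kronecker product of matrices. For functions, $(a_1\otimes\cdots\otimes a_d)(\boldsymbol x)=a_1(\boldsymbol x_1)\cdots a_d(\boldsymbol x_d)$ for $\boldsymbol x=(\boldsymbol x_1,\ldots,\boldsymbol x_d)$ with $\boldsymbol x_i\in[0,1]^{|\boldsymbol n_i|}$. **Permutation matrices.** $\mathbf e^{(n)}_1,\ldots,\mathbf e^{(n)}_n$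 is the canonical basis of $\mathbb C^n$. For positive integers $n_1,n_2$, $P_{n_1,n_2}=\sum_{i=1}^{n_2}\mathbf e_i^{(n_2)}\otimes I_{n_1}\otimes(\mathbf e_i^{(n_2)})^T$, the $n_1n_2\times n_1n_2$ permutation matrix whose $i$th row is $(\mathbf e^{(n_1n_2)}_{\zeta(i)})^T$ with $\zeta(i)=((i-1)\bmod n_1)n_2+\lfloor(i-1)/n_1\rfloor+1$. A permutation $\sigma$ of $\{1,\ldots,d\}$ is written $[\sigma(1),\ldots,\sigma(d)]$. For positive integers $n_1,\ldots,n_d$, the permutation matrix $\Gamma_{n_1,\ldots,n_d}(\sigma)$ of size $n_1\cdots n_d$ is defined recursively: $\Gamma_{n_1}([1])=I_{n_1}$; $\Gamma_{n_1,n_2}([1,2])=I_{n_1n_2}$, $\Gamma_{n_1,n_2}([2,1])=P_{n_1,n_2}$; for $d\ge3$, $$\Gamma_{n_1,\ldots,n_d}(\sigma)=\bigl(I_{n_{\sigma(1)}\cdots n_{\sigma(i-1)}}\otimes P_{n_{\sigma(i+1)}\cdots n_{\sigma(d)},\,n_d}\bigr)\bigl(\Gamma_{n_1,\ldots,n_{d-1}}(\tau)\otimes I_{n_d}\bigr),$$ where $i$ is the index with $\sigma(i)=d$, $\tau=[\sigma(1),\ldots,\sigma(i-1),\sigma(i+1),\ldots,\sigma(d)]$, and empty products equal $1$. Finally, for positive integers $p_1,\ldots,p_d,q_1,\ldots,q_d$, $$\Pi_{p_1,\ldots,p_d}^{q_1,\ldots,q_d}=\Gamma_{p_1,\ldots,p_d,q_1,\ldots,q_d}([1,d+1,2,d+2,\ldots,d,2d]).$$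 *)

theory Defs
  imports Complex_Main "Jordan_Normal_Form.Matrix"
begin

text \<open>Multi-indices are lists of natural numbers, points of \<open>[0,1]\<^sup>q\<close> are lists of \<open>q\<close> reals, so that
  concatenation of multi-indices is list append. Only the values of a function at the sample points
  \<open>i/n\<close> with \<open>1 \<le> i \<le> n\<close>, which lie in \<open>[0,1]\<^sup>q\<close>, are ever used; functions on \<open>[0,1]\<^sup>q\<close> are therefore
  represented by total functions on real lists.\<close>

definition multi_size :: "nat list \<Rightarrow> nat" where
  "multi_size m = prod_list m"

definition multi_range :: "nat list \<Rightarrow> nat list list" where
  "multi_range n = product_lists (map (\<lambda>m. [1..<Suc m]) n)"

lemma set_multi_range:
  "set (multi_range n) = {i. list_all2 (\<lambda>k m. 1 \<le> k \<and> k \<le> m) i n}"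
  by (auto simp: multi_range_def product_lists_set list_all2_map2 elim!: list_all2_mono)

lemma sorted_multi_range:
  "sorted_wrt (\<lambda>i j. (i, j) \<in> lexord {(k, l). k < l}) (multi_range n)"
proof (induction n)
  case Nil
  show ?case by (simp add: multi_range_def)
next
  case (Cons m n)
  have "sorted_wrt (\<lambda>i j. (i, j) \<in> lexord {(k, l). k < l})
      (concat (map (\<lambda>x. map ((#) x) (multi_range n)) xs))" if "sorted_wrt (<) xs" for xs :: "nat list"
    using that
  proof (induction xs)
    case Nil
    show ?case by simp
  next
    case (Cons x xs)
    then show ?case
      using \<open>sorted_wrt _ (multi_range n)\<close> by (auto simp: sorted_wrt_append sorted_wrt_map)
  qed
  from this[of "[1..<Suc m]"] show ?case
    by (simp add: multi_range_def del: upt_Suc)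
qed

definition multi_div :: "nat list \<Rightarrow> nat list \<Rightarrow> real list" where
  "multi_div i n = map2 (\<lambda>k m. real k / real m) i n"

definition diag_sampling :: "nat list \<Rightarrow> (real list \<Rightarrow> complex mat) \<Rightarrow> complex mat" where
  "diag_sampling n a = diag_block_mat (map (\<lambda>i. a (multi_div i n)) (multi_range n))"

text \<open>The case of a scalar function, with \<open>\<complex>\<close> identified with the \<open>1 \<times> 1\<close> matrices.\<close>

definition diag_sampling_scalar :: "nat list \<Rightarrow> (real list \<Rightarrow> complex) \<Rightarrow> complex mat" where
  "diag_sampling_scalar n a = diag_sampling n (\<lambda>x. mat 1 1 (\<lambda>_. a x))"

definition kron :: "complex mat \<Rightarrow> complex mat \<Rightarrow> complex mat" (infixl \<open>\<otimes>\<^sub>K\<close> 75) where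
  "X \<otimes>\<^sub>K Y = mat (dim_row X * dim_row Y) (dim_col X * dim_col Y)
     (\<lambda>(i, j). X $$ (i div dim_row Y, j div dim_col Y) * Y $$ (i mod dim_row Y, j mod dim_col Y))"

lemma kron_entry: "i < dim_row X * dim_row Y \<Longrightarrow> j < dim_col X * dim_col Y \<Longrightarrow>
  (X \<otimes>\<^sub>K Y) $$ (i,j) = X $$ (i div dim_row Y, j div dim_col Y) * Y $$ (i mod dim_row Y, j mod dim_col Y)"
  by (simp add: kron_def)

lemma kron_dim [simp]: "dim_row (X \<otimes>\<^sub>K Y) = dim_row X * dim_row Y" "dim_col (X \<otimes>\<^sub>K Y) = dim_col X * dim_col Y"
  by (simp_all add: kron_def)

definition kron_list :: "complex mat list \<Rightarrow> complex mat" where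
  "kron_list Xs = foldr (\<otimes>\<^sub>K) Xs (1\<^sub>m 1)"

text \<open>\<open>tensor_fun qs as\<close> is the function sending the concatenation of points \<open>x\<^sub>k\<close> of lengths
  \<open>qs ! k\<close> to the product of the \<open>(as ! k) x\<^sub>k\<close>. The block \<open>x\<^sub>k\<close> is recovered from the lengths.\<close>

definition tensor_fun :: "nat list \<Rightarrow> (real list \<Rightarrow> complex) list \<Rightarrow> real list \<Rightarrow> complex" where
  "tensor_fun qs as x = (\<Prod>k<length as. (as ! k) (take (qs ! k) (drop (sum_list (take k qs)) x)))"

definition col_mat :: "complex vec \<Rightarrow> complex mat" where
  "col_mat v = mat_of_cols (dim_vec v) [v]"

lemma col_mat_simps [simp]: "dim_row (col_mat v) = dim_vec v" "dim_col (col_mat v) = 1"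
  "i < dim_vec v \<Longrightarrow> col_mat v $$ (i, 0) = v $ i"
  by (simp_all add: col_mat_def mat_of_cols_index)

text \<open>Vector and matrix indices start at \<open>0\<close>, so the sum over the canonical basis
  runs over \<open>[0..<n2]\<close>.\<close>

definition P_mat :: "nat \<Rightarrow> nat \<Rightarrow> complex mat" where
  "P_mat n1 n2 = foldr (+)
     (map (\<lambda>i. col_mat (unit_vec n2 i) \<otimes>\<^sub>K 1\<^sub>m n1 \<otimes>\<^sub>K (col_mat (unit_vec n2 i))\<^sup>T) [0..<n2])
     (0\<^sub>m (n1 * n2) (n1 * n2))"

text \<open>The explicit form of the permutation matrix, i.e. the map \<open>\<zeta>\<close> with indices shifted to start at \<open>0\<close>.\<close>

lemma P_mat_eq:
  "P_mat n1 n2 = mat (n1 * n2) (n1 * n2) (\<lambda>(i, j). if j = (i mod n1) * n2 + i div n1 then 1 else 0)"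
proof -
  let ?E = "\<lambda>i. col_mat (unit_vec n2 i) \<otimes>\<^sub>K 1\<^sub>m n1 \<otimes>\<^sub>K (col_mat (unit_vec n2 i))\<^sup>T"
  have E: "?E k $$ (i, j) = (if k = i div n1 \<and> k = j mod n2 \<and> i mod n1 = j div n2 then 1 else 0)"
    if "i < n1 * n2" "j < n1 * n2" "k < n2" for i j k
  proof -
    have "n1 > 0" "n2 > 0" using that by (cases n1; cases n2; simp)+
    moreover have "i div n1 < n2" "j div n2 < n1"
      using that by (simp_all add: less_mult_imp_div_less mult.commute)
    ultimately show ?thesis using that
      by (auto simp: kron_entry mult.commute unit_vec_def)
  qed
  have F: "foldr (+) (map ?E ks) (0\<^sub>m (n1 * n2) (n1 * n2)) = mat (n1 * n2) (n1 * n2)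
      (\<lambda>(i, j). \<Sum>k\<leftarrow>ks. if k = i div n1 \<and> k = j mod n2 \<and> i mod n1 = j div n2 then 1 else 0)"
    if "set ks \<subseteq> {..<n2}" for ks
    using that by (induction ks) (auto intro!: eq_matI simp: E mult.commute)
  have G: "(j = (i mod n1) * n2 + i div n1) = (i div n1 = j mod n2 \<and> i mod n1 = j div n2)"
    if "i < n1 * n2" for i j
  proof -
    have "i div n1 < n2" using that by (simp add: less_mult_imp_div_less mult.commute)
    then show ?thesis by (auto simp: mult.commute)
  qed
  have B: "i div n1 < n2" if "i < n1 * n2" for i
    using that by (simp add: less_mult_imp_div_less mult.commute)
  have F0: "set [0..<n2] \<subseteq> {..<n2}" by auto
  show ?thesis
    unfolding P_mat_def
  proof (subst F[OF F0], rule eq_matI, goal_cases)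
    case (1 i j)
    then have i: "i < n1 * n2" and j: "j < n1 * n2" by simp_all
    have "(\<Sum>k\<leftarrow>[0..<n2]. if k = i div n1 \<and> k = j mod n2 \<and> i mod n1 = j div n2 then 1 else 0) =
        (\<Sum>k\<in>{0..<n2}. if k = i div n1 then (if i div n1 = j mod n2 \<and> i mod n1 = j div n2 then 1 else 0) else (0::complex))"
      by (subst sum_list_distinct_conv_sum_set) (auto intro!: sum.neutral)
    also have "\<dots> = (if i div n1 = j mod n2 \<and> i mod n1 = j div n2 then 1 else 0)"
      using B[OF i] by (subst sum.delta) auto
    finally show ?case using i j by (simp add: G[OF i])
  qed simp_all
qed
text \<open>A permutation \<open>\<sigma>\<close> of \<open>{1,\<dots>,d}\<close> is given by the list \<open>[\<sigma> 1, \<dots>, \<sigma> d]\<close>. In the recursive case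
  \<open>l\<close> and \<open>r\<close> are the parts of this list before and after the entry \<open>d\<close>, so that \<open>\<tau> = l @ r\<close>.
  The value at the empty list is not used.\<close>

fun Gamma_mat :: "nat list \<Rightarrow> nat list \<Rightarrow> complex mat" where
  "Gamma_mat [] \<sigma> = 1\<^sub>m 1"
| "Gamma_mat [n1] \<sigma> = 1\<^sub>m n1"
| "Gamma_mat [n1, n2] \<sigma> = (if \<sigma> = [2, 1] then P_mat n1 n2 else 1\<^sub>m (n1 * n2))"
| "Gamma_mat (n1 # n2 # n3 # ns') \<sigma> =
     (let ns = n1 # n2 # n3 # ns'; d = length ns;
          l = takeWhile (\<lambda>j. j \<noteq> d) \<sigma>; r = tl (dropWhile (\<lambda>j. j \<noteq> d) \<sigma>);
          size = (\<lambda>js. prod_list (map (\<lambda>j. ns ! (j - 1)) js))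
      in (1\<^sub>m (size l) \<otimes>\<^sub>K P_mat (size r) (last ns)) * (Gamma_mat (butlast ns) (l @ r) \<otimes>\<^sub>K 1\<^sub>m (last ns)))"

definition Pi_mat :: "nat list \<Rightarrow> nat list \<Rightarrow> complex mat" where
  "Pi_mat ps qs = (let d = length ps in Gamma_mat (ps @ qs) (concat (map (\<lambda>k. [k, d + k]) [1..<Suc d])))"

end

theory Submission
  imports Defs
begin

text \<open>Both sides are Kronecker products of the same factors in a different order. Indeed
  \<open>D\<^sub>n(b I\<^sub>s) = D\<^sub>n(b) \<otimes> I\<^sub>s\<close>, and by the lexicographic ordering \<open>D\<^sub>n(a\<^sub>1 \<otimes> \<dots> \<otimes> a\<^sub>d)\<close> is the
  Kronecker product of the \<open>D\<^sub>n\<^sub>i(a\<^sub>i)\<close>. Conjugation by \<open>\<Gamma>(\<sigma>)\<close> rearranges the factors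
  of a Kronecker product of square matrices according to \<open>\<sigma>\<close>, and the permutation defining \<open>\<Pi>\<close>
  interleaves the factors \<open>D\<^sub>n\<^sub>i(a\<^sub>i)\<close> with the factors \<open>I\<^sub>s\<^sub>i\<close>.\<close>

section \<open>Algebra of the Kronecker product\<close>

text \<open>Grouping by quotient and remainder modulo \<open>n\<close>; in \<open>kron_mult\<close>
  this splits the inner summation index into its two Kronecker components.\<close>

lemma sum_lessThan_mult:
  fixes f :: "nat \<Rightarrow> 'a::comm_monoid_add"
  shows "(\<Sum>k<m * n. f k) = (\<Sum>i<m. \<Sum>j<n. f (i * n + j))"
proof -
  have "(\<Sum>j = i * n..<i * n + n. f j) = (\<Sum>j<n. f (i * n + j))" for i
    using sum.shift_bounds_nat_ivl[of f 0 "i * n" n]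
    by (simp add: atLeast0LessThan add.commute)
  then show ?thesis
    by (simp flip: sum.nat_group)
qed

lemma div_mod_less_mult:
  fixes i m n :: nat
  assumes "i < m * n"
  shows "i div n < m" "i mod n < n"
proof -
  show "i div n < m" using assms by (simp add: less_mult_imp_div_less)
  have "n > 0" using assms by (cases n) auto
  then show "i mod n < n" by simp
qed

lemma kron_carrier:
  "A \<in> carrier_mat m n \<Longrightarrow> B \<in> carrier_mat p q \<Longrightarrow> A \<otimes>\<^sub>K B \<in> carrier_mat (m * p) (n * q)"
  by (intro carrier_matI) auto

lemma kron_one [simp]: "A \<otimes>\<^sub>K 1\<^sub>m (Suc 0) = A"
  by (rule eq_matI) (auto simp: kron_entry)

lemma one_kron [simp]: "1\<^sub>m (Suc 0) \<otimes>\<^sub>K A = A"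
  by (rule eq_matI) (auto simp: kron_entry)

lemma one_kron_one: "1\<^sub>m m \<otimes>\<^sub>K 1\<^sub>m n = 1\<^sub>m (m * n)"
proof (rule eq_matI, goal_cases)
  case (1 i j)
  then have i: "i < m * n" and j: "j < m * n" by simp_all
  have "i = j \<longleftrightarrow> i div n = j div n \<and> i mod n = j mod n"
    by (metis div_mult_mod_eq)
  then show ?case
    using i j div_mod_less_mult[OF i] div_mod_less_mult[OF j] by (auto simp: kron_entry)
qed simp_all

lemma kron_transpose: "(A \<otimes>\<^sub>K B)\<^sup>T = A\<^sup>T \<otimes>\<^sub>K B\<^sup>T"
proof (rule eq_matI, goal_cases)
  case (1 i j)
  then have i: "i < dim_col A * dim_col B" and j: "j < dim_row A * dim_row B" by simp_all
  then show ?case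
    using div_mod_less_mult[OF i] div_mod_less_mult[OF j] by (simp add: kron_entry)
qed simp_all

text \<open>Either bracketing reads an index as three mixed-radix digits, and the facts
  \<open>d\<close> say that the digits agree.\<close>

lemma kron_assoc: "(A \<otimes>\<^sub>K B) \<otimes>\<^sub>K C = A \<otimes>\<^sub>K (B \<otimes>\<^sub>K C)"
proof (rule eq_matI, goal_cases)
  case (1 i j)
  then have i: "i < dim_row A * dim_row B * dim_row C" and j: "j < dim_col A * dim_col B * dim_col C"
    by (simp_all add: mult.assoc)
  have i': "i < dim_row A * (dim_row B * dim_row C)" and j': "j < dim_col A * (dim_col B * dim_col C)"
    using i j by (simp_all add: mult.assoc)
  have d: "k div c div b = k div (b * c)" "k mod (b * c) div c = k div c mod b"
    "k mod (b * c) mod c = k mod c" for k b c :: nat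
    unfolding mult.commute[of b c] by (cases "c = 0"; simp add: div_mult2_eq mod_mult2_eq)+
  show ?case
    using i j i' j' div_mod_less_mult[OF i] div_mod_less_mult[OF j]
      div_mod_less_mult[OF i'] div_mod_less_mult[OF j']
    by (simp add: kron_entry d)
qed (simp_all add: mult.assoc)

text \<open>The mixed-product property: once the inner index is split into a pair
  \<open>(p, q)\<close>, every summand separates into a factor in \<open>p\<close> and a factor in
  \<open>q\<close>, so the double sum is a product of two sums.\<close>

lemma kron_mult:
  assumes "dim_col A = dim_row C" "dim_col B = dim_row D"
  shows "(A \<otimes>\<^sub>K B) * (C \<otimes>\<^sub>K D) = (A * C) \<otimes>\<^sub>K (B * D)"
proof (rule eq_matI, goal_cases)
  case (1 i j)
  then have i: "i < dim_row A * dim_row B" and j: "j < dim_col C * dim_col D"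
    by simp_all
  note ij = i j div_mod_less_mult[OF i] div_mod_less_mult[OF j]
  let ?m = "dim_row C" and ?n = "dim_row D"
  have "((A \<otimes>\<^sub>K B) * (C \<otimes>\<^sub>K D)) $$ (i, j) = (\<Sum>k<?m * ?n. (A \<otimes>\<^sub>K B) $$ (i, k) * (C \<otimes>\<^sub>K D) $$ (k, j))"
    using ij assms by (simp add: scalar_prod_def atLeast0LessThan)
  also have "\<dots> = (\<Sum>k<?m * ?n. A $$ (i div dim_row B, k div ?n) * B $$ (i mod dim_row B, k mod ?n) *
      (C $$ (k div ?n, j div dim_col D) * D $$ (k mod ?n, j mod dim_col D)))"
    using ij assms by (intro sum.cong) (auto simp: kron_entry)
  also have "\<dots> = (\<Sum>p<?m. \<Sum>q<?n. (A $$ (i div dim_row B, p) * C $$ (p, j div dim_col D)) *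
      (B $$ (i mod dim_row B, q) * D $$ (q, j mod dim_col D)))"
    unfolding sum_lessThan_mult by (intro sum.cong refl) simp
  also have "\<dots> = (A * C) $$ (i div dim_row B, j div dim_col D) * (B * D) $$ (i mod dim_row B, j mod dim_col D)"
    using ij assms by (simp add: scalar_prod_def atLeast0LessThan sum_product)
  also have "\<dots> = ((A * C) \<otimes>\<^sub>K (B * D)) $$ (i, j)"
    using ij by (simp add: kron_entry)
  finally show ?case .
qed simp_all

lemma kron_conj:
  assumes "G \<in> carrier_mat m m" "X \<in> carrier_mat m m" "H \<in> carrier_mat n n" "Y \<in> carrier_mat n n"
  shows "(G \<otimes>\<^sub>K H) * (X \<otimes>\<^sub>K Y) * (G \<otimes>\<^sub>K H)\<^sup>T = (G * X * G\<^sup>T) \<otimes>\<^sub>K (H * Y * H\<^sup>T)"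
  using assms by (simp add: kron_transpose kron_mult)

text \<open>The recursion gives \<Gamma> as a product of two matrices; this allows conjugation by
  one of them at a time, the right one first.\<close>

lemma mult_conj:
  fixes A B X :: "'a::comm_semiring_0 mat"
  assumes "A \<in> carrier_mat n n" "B \<in> carrier_mat n n" "X \<in> carrier_mat n n"
  shows "(A * B) * X * (A * B)\<^sup>T = A * (B * X * B\<^sup>T) * A\<^sup>T"
proof -
  have t: "A\<^sup>T \<in> carrier_mat n n" "B\<^sup>T \<in> carrier_mat n n"
    using assms by simp_all
  have "A * B * X * (B\<^sup>T * A\<^sup>T) = A * B * X * B\<^sup>T * A\<^sup>T"
    using assms t by (intro assoc_mult_mat[symmetric] mult_carrier_mat)
  also have "A * B * X = A * (B * X)"
    using assms by (intro assoc_mult_mat)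
  also have "A * (B * X) * B\<^sup>T = A * (B * X * B\<^sup>T)"
    using assms t by (intro assoc_mult_mat mult_carrier_mat)
  finally show ?thesis
    using assms by (simp add: transpose_mult)
qed

section \<open>Swapping two Kronecker factors\<close>

lemma P_mat_carrier [simp]: "P_mat m n \<in> carrier_mat (m * n) (m * n)"
  by (simp add: P_mat_eq)

lemma P_mat_dim [simp]: "dim_row (P_mat m n) = m * n" "dim_col (P_mat m n) = m * n"
  by (simp_all add: P_mat_eq)

text \<open>Row \<open>k\<close> of \<open>P_mat m n\<close> has its single one in column
  \<open>z k\<close>, so conjugation moves entry \<open>(z i, z j)\<close> to \<open>(i, j)\<close>.
  By \<open>zd\<close>, the map \<open>z\<close> exchanges the quotient and remainder of an index,
  and this exchanges the two factors.\<close>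

lemma P_mat_conj:
  assumes X: "X \<in> carrier_mat m m" and Y: "Y \<in> carrier_mat n n"
  shows "P_mat m n * (X \<otimes>\<^sub>K Y) * (P_mat m n)\<^sup>T = Y \<otimes>\<^sub>K X"
proof (rule eq_matI, goal_cases)
  case (1 i j)
  then have i: "i < n * m" and j: "j < n * m" using X Y by auto
  \<comment> \<open>The map \<zeta> of the definition with indices starting at 0.\<close>
  define z where "z k = (k mod m) * n + k div m" for k
  have zl: "z k < m * n" if "k < n * m" for k
  proof -
    have "k mod m \<le> m - 1" "k div m < n" "m > 0"
      using div_mod_less_mult[OF that] by auto
    then have "z k < (m - 1) * n + n"
      unfolding z_def by (intro add_le_less_mono mult_right_mono) auto
    then show ?thesis using \<open>m > 0\<close> by (cases m) (auto simp: algebra_simps)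
  qed
  have zd: "z k div n = k mod m" "z k mod n = k div m" if "k < n * m" for k
    using div_mod_less_mult[OF that] by (auto simp: z_def)
  have P: "P_mat m n $$ (k, l) = (if l = z k then 1 else 0)" if "k < n * m" "l < n * m" for k l
    using that by (simp add: P_mat_eq z_def mult.commute)
  have XY: "X \<otimes>\<^sub>K Y \<in> carrier_mat (m * n) (m * n)" using X Y by (rule kron_carrier)
  have PX: "(P_mat m n * (X \<otimes>\<^sub>K Y)) $$ (i, l) = (X \<otimes>\<^sub>K Y) $$ (z i, l)" if l: "l < n * m" for l
  proof -
    have "(P_mat m n * (X \<otimes>\<^sub>K Y)) $$ (i, l) = (\<Sum>k<n * m. P_mat m n $$ (i, k) * (X \<otimes>\<^sub>K Y) $$ (k, l))"
      using i l X Y by (simp add: scalar_prod_def atLeast0LessThan mult.commute)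
    also have "\<dots> = (\<Sum>k<n * m. if k = z i then (X \<otimes>\<^sub>K Y) $$ (k, l) else 0)"
      using i by (intro sum.cong) (auto simp: P)
    also have "\<dots> = (X \<otimes>\<^sub>K Y) $$ (z i, l)"
      using zl[OF i] by (simp add: mult.commute)
    finally show ?thesis .
  qed
  have "(P_mat m n * (X \<otimes>\<^sub>K Y) * (P_mat m n)\<^sup>T) $$ (i, j) =
      (\<Sum>l<n * m. (P_mat m n * (X \<otimes>\<^sub>K Y)) $$ (i, l) * P_mat m n $$ (j, l))"
    using i j X Y by (simp add: scalar_prod_def atLeast0LessThan mult.commute)
  also have "\<dots> = (\<Sum>l<n * m. if l = z j then (X \<otimes>\<^sub>K Y) $$ (z i, l) else 0)"
    using j by (intro sum.cong) (auto simp: P PX)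
  also have "\<dots> = (X \<otimes>\<^sub>K Y) $$ (z i, z j)"
    using zl[OF j] by (simp add: mult.commute)
  also have "\<dots> = (Y \<otimes>\<^sub>K X) $$ (i, j)"
    using i j X Y zl[OF i] zl[OF j] by (simp add: kron_entry zd)
  finally show ?case .
qed (use X Y in auto)

section \<open>Kronecker products of lists\<close>

lemma kron_list_simps [simp]:
  "kron_list [] = 1\<^sub>m 1"
  "kron_list (X # Xs) = X \<otimes>\<^sub>K kron_list Xs"
  by (simp_all add: kron_list_def)

lemma kron_list_append: "kron_list (Xs @ Ys) = kron_list Xs \<otimes>\<^sub>K kron_list Ys"
  by (induction Xs) (simp_all add: kron_assoc)

lemma kron_list_concat: "kron_list (concat Xss) = kron_list (map kron_list Xss)"
  by (induction Xss) (simp_all add: kron_list_append)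

lemma kron_list_one: "kron_list (map 1\<^sub>m ks) = 1\<^sub>m (prod_list ks)"
  by (induction ks) (simp_all add: one_kron_one)

lemma kron_list_carrier:
  "list_all2 (\<lambda>n X. X \<in> carrier_mat n n) ns Xs \<Longrightarrow>
    kron_list Xs \<in> carrier_mat (prod_list ns) (prod_list ns)"
  by (induction rule: list_all2_induct) (auto intro: kron_carrier)

section \<open>Conjugation by \<Gamma>\<close>

lemma prod_list_nth_perm:
  fixes ns :: "'a::comm_monoid_mult list"
  assumes "distinct js" "set js = {1..length ns}"
  shows "prod_list (map (\<lambda>j. ns ! (j - 1)) js) = prod_list ns"
proof -
  have "prod_list (map (\<lambda>j. ns ! (j - 1)) js) = (\<Prod>j = 1..length ns. ns ! (j - 1))"
    using assms prod.distinct_set_conv_list[OF assms(1), of "\<lambda>j. ns ! (j - 1)"] by simp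
  also have "\<dots> = (\<Prod>i<length ns. ns ! i)"
    by (rule prod.reindex_bij_witness[of _ Suc "\<lambda>j. j - 1"]) auto
  finally show ?thesis
    by (simp add: prod.list_conv_set_nth atLeast0LessThan)
qed

text \<open>The recursion removes the last dimension, while the defining equation matches on the
  first three entries. This form fits an induction from the right; as \<open>l\<close> avoids the
  largest index, \<open>takeWhile\<close> stops exactly after \<open>l\<close>.\<close>

lemma Gamma_mat_snoc:
  assumes "length ns \<ge> 2" "Suc (length ns) \<notin> set l"
  shows "Gamma_mat (ns @ [m]) (l @ Suc (length ns) # r) =
    (1\<^sub>m (prod_list (map (\<lambda>j. (ns @ [m]) ! (j - 1)) l)) \<otimes>\<^sub>K
      P_mat (prod_list (map (\<lambda>j. (ns @ [m]) ! (j - 1)) r)) m) * (Gamma_mat ns (l @ r) \<otimes>\<^sub>K 1\<^sub>m m)"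
proof -
  obtain n1 n2 ns' where ns: "ns = n1 # n2 # ns'"
    using assms(1) by (cases ns; cases "tl ns") auto
  obtain n3 ns'' where ns': "ns' @ [m] = n3 # ns''"
    by (cases "ns' @ [m]") auto
  have e: "ns @ [m] = n1 # n2 # n3 # ns''" by (simp add: ns ns')
  have "length (n1 # n2 # n3 # ns'') = Suc (length ns)" "butlast (n1 # n2 # n3 # ns'') = ns"
    "last (n1 # n2 # n3 # ns'') = m"
    by (simp_all flip: e)
  moreover have "takeWhile (\<lambda>j. j \<noteq> Suc (length ns)) (l @ Suc (length ns) # r) = l"
    "dropWhile (\<lambda>j. j \<noteq> Suc (length ns)) (l @ Suc (length ns) # r) = Suc (length ns) # r"
    using assms(2) by (auto simp: takeWhile_append dropWhile_append)
  ultimately show ?thesis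
    unfolding e Gamma_mat.simps Let_def by simp
qed

text \<open>Induction along the recursion. With \<sigma> equal to \<open>l\<close>, then the largest
  index, then \<open>r\<close>, the right factor of \<Gamma> arranges all matrices but the last
  according to \<open>l @ r\<close>, leaving the last one, \<open>Y\<close>, at the end. The left
  factor then moves \<open>Y\<close> past the block belonging to \<open>r\<close>, to the place
  where \<sigma> has its largest entry.\<close>

theorem Gamma_mat_conj:
  assumes "distinct \<sigma>" "set \<sigma> = {1..length ns}" "list_all2 (\<lambda>n X. X \<in> carrier_mat n n) ns Xs"
  shows "Gamma_mat ns \<sigma> \<in> carrier_mat (prod_list ns) (prod_list ns)"
    and "Gamma_mat ns \<sigma> * kron_list Xs * (Gamma_mat ns \<sigma>)\<^sup>T = kron_list (map (\<lambda>j. Xs ! (j - 1)) \<sigma>)"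
proof -
  have "Gamma_mat ns \<sigma> \<in> carrier_mat (prod_list ns) (prod_list ns) \<and>
    Gamma_mat ns \<sigma> * kron_list Xs * (Gamma_mat ns \<sigma>)\<^sup>T = kron_list (map (\<lambda>j. Xs ! (j - 1)) \<sigma>)"
    using assms
  proof (induction ns arbitrary: \<sigma> Xs rule: rev_induct)
    case Nil
    then show ?case by simp
  next
    case (snoc m ns)
    have "Suc (length ns) \<in> set \<sigma>" using snoc.prems(2) by simp
    then obtain l r where \<sigma>: "\<sigma> = l @ Suc (length ns) # r" and nl: "Suc (length ns) \<notin> set l"
      by (meson split_list_first)
    have nr: "Suc (length ns) \<notin> set r" and dlr: "distinct (l @ r)"
      using snoc.prems(1) by (auto simp: \<sigma>)
    have "set (l @ r) = set \<sigma> - {Suc (length ns)}" using nl nr by (auto simp: \<sigma>)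
    then have slr: "set (l @ r) = {1..length ns}" using snoc.prems(2) by auto
    obtain Ys Y where Xs: "Xs = Ys @ [Y]" and Ys: "list_all2 (\<lambda>n X. X \<in> carrier_mat n n) ns Ys"
      and Y: "Y \<in> carrier_mat m m"
      using snoc.prems(3) by (auto simp: list_all2_append1 list_all2_Cons1)
    have len: "length Ys = length ns" using Ys by (simp add: list_all2_lengthD)
    note IH = snoc.IH[OF dlr slr Ys]
    \<comment> \<open>\<open>f js\<close> and \<open>K js\<close> are the dimension and the
      Kronecker product of the factors selected by \<open>js\<close>. Entries of \<open>l\<close>
      and \<open>r\<close> point into \<open>ns\<close>, so appending \<open>m\<close> or
      \<open>Y\<close> changes neither.\<close>
    define f where "f js = prod_list (map (\<lambda>j. ns ! (j - 1)) js)" for js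
    define K where "K js = kron_list (map (\<lambda>j. Ys ! (j - 1)) js)" for js
    have in_range: "j - 1 < length ns" if "j \<in> set l \<union> set r" for j
    proof -
      have "j \<in> {1..length ns}" using that slr by auto
      then show ?thesis by auto
    qed
    have f: "prod_list (map (\<lambda>j. (ns @ [m]) ! (j - 1)) js) = f js"
      and K: "kron_list (map (\<lambda>j. (Ys @ [Y]) ! (j - 1)) js) = K js"
      and KC: "K js \<in> carrier_mat (f js) (f js)"
      if "set js \<subseteq> set l \<union> set r" for js
    proof -
      have r: "j - 1 < length ns" if "j \<in> set js" for j
        using \<open>set js \<subseteq> _\<close> in_range that by blast
      show "prod_list (map (\<lambda>j. (ns @ [m]) ! (j - 1)) js) = f js"
        unfolding f_def using r by (intro arg_cong[of _ _ prod_list] map_cong) (auto simp: nth_append)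
      show "kron_list (map (\<lambda>j. (Ys @ [Y]) ! (j - 1)) js) = K js"
        unfolding K_def using r len by (intro arg_cong[of _ _ kron_list] map_cong) (auto simp: nth_append)
      show "K js \<in> carrier_mat (f js) (f js)"
        unfolding f_def K_def using r Ys
        by (intro kron_list_carrier)
          (use list_all2_nthD[OF Ys] in \<open>auto simp: list_all2_map1 list_all2_map2 list_all2_same\<close>)
    qed
    have f_lr: "f l * f r = prod_list ns"
      using prod_list_nth_perm[OF dlr slr] unfolding f_def map_append prod_list.append .
    have "Xs ! (Suc (length ns) - 1) = Y"
      using len by (simp add: Xs nth_append)
    then have KlY: "kron_list (map (\<lambda>j. Xs ! (j - 1)) \<sigma>) = K l \<otimes>\<^sub>K (Y \<otimes>\<^sub>K K r)"
      unfolding \<sigma> map_append list.map kron_list_append kron_list_simps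
      unfolding Xs using K[of l] K[of r] by (simp only: Un_upper1 Un_upper2)
    \<comment> \<open>With \<open>m\<close> appended these are one, two, and at least three
      dimensions, matching the separate clauses of \<open>Gamma_mat\<close>.\<close>
    consider (zero) "ns = []" | (one) k where "ns = [k]" | (many) "length ns \<ge> 2"
      by (cases ns; cases "tl ns") auto
    then show ?case
    proof cases
      case zero
      with slr have "l = []" "r = []" by auto
      then show ?thesis using Y Ys by (simp add: \<sigma> Xs zero)
    next
      case (one k)
      then obtain Z where Z: "Ys = [Z]" "Z \<in> carrier_mat k k"
        using Ys one by (cases Ys) auto
      have "length (l @ r) = 1"
        using distinct_card[OF dlr] slr one by simp
      then obtain x where "l @ r = [x]"
        unfolding One_nat_def length_Suc_conv length_0_conv by blast
      with slr one have "l @ r = [1]" by simp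
      then consider "l = [1]" "r = []" | "l = []" "r = [1]"
        by (auto simp: append_eq_Cons_conv)
      then show ?thesis
      proof cases
        case 1
        then show ?thesis using Y Z by (simp add: \<sigma> Xs one kron_carrier)
      next
        case 2
        then show ?thesis using Y Z by (simp add: \<sigma> Xs one P_mat_conj)
      qed
    next
      case many
      let ?A = "1\<^sub>m (f l) \<otimes>\<^sub>K P_mat (f r) m" and ?B = "Gamma_mat ns (l @ r) \<otimes>\<^sub>K 1\<^sub>m m"
      let ?N = "prod_list (ns @ [m])"
      have G: "Gamma_mat (ns @ [m]) \<sigma> = ?A * ?B"
        unfolding \<sigma> Gamma_mat_snoc[OF many nl] using f[of l] f[of r] by simp
      \<comment> \<open>The two factors of \<Gamma> arrive with differently bracketed sizes; by
        \<open>f_lr\<close> both equal the total dimension.\<close>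
      have N: "f l * (f r * m) = ?N" by (simp add: f_lr flip: mult.assoc)
      have A: "?A \<in> carrier_mat ?N ?N"
        using kron_carrier[OF one_carrier_mat[of "f l"] P_mat_carrier[of "f r" m]] by (simp only: N)
      have B: "?B \<in> carrier_mat ?N ?N"
        using kron_carrier[OF conjunct1[OF IH] one_carrier_mat[of m]] by simp
      have X: "kron_list Ys \<otimes>\<^sub>K Y \<in> carrier_mat ?N ?N"
        using kron_carrier[OF kron_list_carrier[OF Ys] Y] by simp
      have "Gamma_mat (ns @ [m]) \<sigma> * kron_list Xs * (Gamma_mat (ns @ [m]) \<sigma>)\<^sup>T =
          (?A * ?B) * (kron_list Ys \<otimes>\<^sub>K Y) * (?A * ?B)\<^sup>T"
        by (simp add: G Xs kron_list_append)
      also have "\<dots> = ?A * (?B * (kron_list Ys \<otimes>\<^sub>K Y) * ?B\<^sup>T) * ?A\<^sup>T"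
        using A B X by (rule mult_conj)
      \<comment> \<open>The induction hypothesis acts on the first component, the identity fixes
        \<open>Y\<close>.\<close>
      also have "?B * (kron_list Ys \<otimes>\<^sub>K Y) * ?B\<^sup>T =
          kron_list (map (\<lambda>j. Ys ! (j - 1)) (l @ r)) \<otimes>\<^sub>K Y"
        using kron_conj[OF conjunct1[OF IH] kron_list_carrier[OF Ys] one_carrier_mat Y] IH Y by simp
      also have "\<dots> = K l \<otimes>\<^sub>K (K r \<otimes>\<^sub>K Y)"
        by (simp add: K_def kron_list_append kron_assoc)
      \<comment> \<open>The identity fixes \<open>K l\<close>, and \<open>P_mat_conj\<close> swaps
        \<open>K r\<close> with \<open>Y\<close>.\<close>
      also have "?A * \<dots> * ?A\<^sup>T = K l \<otimes>\<^sub>K (Y \<otimes>\<^sub>K K r)"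
        using kron_conj[OF one_carrier_mat KC[of l] P_mat_carrier kron_carrier[OF KC[of r] Y]]
          KC[of l] KC[of r] Y by (simp add: P_mat_conj)
      finally show ?thesis
        using A B KlY G by simp
    qed
  qed
  then show "Gamma_mat ns \<sigma> \<in> carrier_mat (prod_list ns) (prod_list ns)"
    and "Gamma_mat ns \<sigma> * kron_list Xs * (Gamma_mat ns \<sigma>)\<^sup>T = kron_list (map (\<lambda>j. Xs ! (j - 1)) \<sigma>)"
    by auto
qed

section \<open>Block diagonal matrices and sampling matrices\<close>

text \<open>An index lies in the first block on the right exactly when its quotient lies in the
  first block on the left; in the second block, subtracting the offset lowers the quotient by the
  block size and keeps the remainder.\<close>

lemma kron_four_block_diag:
  "four_block_mat A (0\<^sub>m (dim_row A) (dim_col D)) (0\<^sub>m (dim_row D) (dim_col A)) D \<otimes>\<^sub>K B =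
   four_block_mat (A \<otimes>\<^sub>K B) (0\<^sub>m (dim_row A * dim_row B) (dim_col D * dim_col B))
     (0\<^sub>m (dim_row D * dim_row B) (dim_col A * dim_col B)) (D \<otimes>\<^sub>K B)"
  (is "?F \<otimes>\<^sub>K B = ?R")
proof (rule eq_matI, goal_cases)
  case (1 i j)
  then have i: "i < (dim_row A + dim_row D) * dim_row B" and j: "j < (dim_col A + dim_col D) * dim_col B"
    by (simp_all add: algebra_simps)
  have split: "k div c < b \<and> k < b * c \<or>
      \<not> k div c < b \<and> \<not> k < b * c \<and> (k - b * c) div c = k div c - b \<and> (k - b * c) mod c = k mod c"
    if "k < q * c" for k b c q :: nat
  proof (cases "k < b * c")
    case True
    then show ?thesis by (simp add: less_mult_imp_div_less)
  next
    case False
    then obtain l where "k = b * c + l" by (metis le_Suc_ex not_less)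
    moreover have "c > 0" using that by (cases c) auto
    ultimately show ?thesis by simp
  qed
  show ?case
    using split[OF i, of "dim_row A"] split[OF j, of "dim_col A"] i j
      div_mod_less_mult[OF i] div_mod_less_mult[OF j]
    by (elim disjE conjE) (simp_all add: kron_entry algebra_simps)
qed (simp_all add: algebra_simps)

lemma kron_diag_block_mat: "diag_block_mat As \<otimes>\<^sub>K B = diag_block_mat (map (\<lambda>A. A \<otimes>\<^sub>K B) As)"
proof (induction As)
  case Nil
  show ?case by (rule eq_matI) auto
next
  case (Cons A As)
  have "sum_list (map dim_row As) * dim_row B = sum_list (map (\<lambda>A. dim_row (A \<otimes>\<^sub>K B)) As)"
    "sum_list (map dim_col As) * dim_col B = sum_list (map (\<lambda>A. dim_col (A \<otimes>\<^sub>K B)) As)"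
    by (simp_all add: sum_list_mult_const)
  then show ?case
    using kron_four_block_diag[of A "diag_block_mat As" B]
    by (simp add: Let_def dim_diag_block_mat o_def flip: Cons.IH)
qed

lemma diag_block_mat_concat: "diag_block_mat (concat Ass) = diag_block_mat (map diag_block_mat Ass)"
  by (induction Ass) (simp_all add: diag_block_mat_append Let_def)

lemma smult_diag_block_mat:
  fixes c :: "'a::mult_zero"
  shows "c \<cdot>\<^sub>m diag_block_mat As = diag_block_mat (map (\<lambda>A. c \<cdot>\<^sub>m A) As)"
proof (induction As)
  case Nil
  show ?case by (rule eq_matI) auto
next
  case (Cons A As)
  show ?case
    unfolding list.map diag_block_mat.simps Let_def Cons.IH[symmetric]
    by (rule eq_matI) auto
qed

text \<open>A scalar multiple of \<open>B\<close> is the Kronecker product of a \<open>1 x 1\<close>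
  matrix with \<open>B\<close>, and right Kronecker multiplication acts block by block. It serves
  for \<open>B\<close> an identity matrix and, in \<open>diag_sampling_scalar_append\<close>, for
  \<open>B\<close> a sampling matrix.\<close>

lemma diag_sampling_smult: "diag_sampling n (\<lambda>x. f x \<cdot>\<^sub>m B) = diag_sampling_scalar n f \<otimes>\<^sub>K B"
proof -
  have "mat 1 1 (\<lambda>_. c) \<otimes>\<^sub>K B = c \<cdot>\<^sub>m B" for c
    by (rule eq_matI) (auto simp: kron_entry)
  then show ?thesis
    by (simp add: diag_sampling_scalar_def diag_sampling_def kron_diag_block_mat o_def)
qed

lemma length_product_lists:
  "length (product_lists xss) = prod_list (map length xss)"
  by (induction xss) (simp_all add: length_concat o_def sum_list_triv)

lemma diag_sampling_scalar_carrier: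
  "diag_sampling_scalar n f \<in> carrier_mat (multi_size n) (multi_size n)"
  by (intro carrier_matI)
    (simp_all add: diag_sampling_scalar_def diag_sampling_def dim_diag_block_mat o_def sum_list_triv
      multi_range_def length_product_lists multi_size_def del: upt_Suc)

text \<open>The lexicographic order is what matters here: equality holds as lists, with the left
  part varying slowest.\<close>

lemma product_lists_append:
  "product_lists (xss @ yss) =
    concat (map (\<lambda>xs. map (\<lambda>ys. xs @ ys) (product_lists yss)) (product_lists xss))"
proof (induction xss)
  case Nil
  show ?case by (simp add: map_idI)
next
  case (Cons zs xss)
  have "concat (concat zsss) = concat (map concat zsss)" for zsss :: "'a list list list list"
    by (induction zsss) simp_all
  moreover have "(@) (z # xs) = (\<lambda>ys. z # xs @ ys)" for z :: 'a and xs
    by (simp add: fun_eq_iff)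
  ultimately show ?case
    by (simp add: Cons map_concat o_def)
qed

lemma multi_range_append:
  "multi_range (m @ n) = concat (map (\<lambda>i. map (\<lambda>j. i @ j) (multi_range n)) (multi_range m))"
  by (simp add: multi_range_def product_lists_append)

text \<open>Group the diagonal by the first part \<open>i\<close> of the index. The group is the
  sampling matrix of \<open>g\<close> scaled by the value of \<open>f\<close> at \<open>i/m\<close>,
  so \<open>diag_sampling_smult\<close> applies. Restricting \<open>x\<close> to the length of
  \<open>m\<close> fixes where a point is cut.\<close>

lemma diag_sampling_scalar_append:
  assumes "\<And>x y. length x = length m \<Longrightarrow> h (x @ y) = f x * g y"
  shows "diag_sampling_scalar (m @ n) h = diag_sampling_scalar m f \<otimes>\<^sub>K diag_sampling_scalar n g"
proof -
  have len: "length i = length m" if "i \<in> set (multi_range m)" for i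
    using that by (auto simp: set_multi_range list_all2_lengthD)
  have sm: "c \<cdot>\<^sub>m mat 1 1 (\<lambda>_. v) = mat 1 1 (\<lambda>_. c * v)" for c v :: complex
    by (rule eq_matI) auto
  have "diag_sampling_scalar (m @ n) h =
    diag_block_mat (map (\<lambda>i. diag_block_mat (map (\<lambda>j. mat 1 1 (\<lambda>_. h (multi_div (i @ j) (m @ n)))) (multi_range n)))
      (multi_range m))"
    by (simp add: diag_sampling_scalar_def diag_sampling_def multi_range_append map_concat o_def
        diag_block_mat_concat)
  also have "\<dots> = diag_block_mat (map (\<lambda>i. f (multi_div i m) \<cdot>\<^sub>m diag_sampling_scalar n g) (multi_range m))"
    unfolding diag_sampling_scalar_def diag_sampling_def smult_diag_block_mat list.map_comp o_def sm
    by (intro arg_cong[of _ _ diag_block_mat] map_cong refl)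
      (simp add: multi_div_def len assms)
  also have "\<dots> = diag_sampling_scalar m f \<otimes>\<^sub>K diag_sampling_scalar n g"
    by (simp add: diag_sampling_def flip: diag_sampling_smult)
  finally show ?thesis .
qed

lemma tensor_fun_Nil [simp]: "tensor_fun [] [] x = 1"
  by (simp add: tensor_fun_def)

text \<open>The factor for \<open>k = 0\<close> reads the first \<open>q\<close> coordinates; every
  later offset contains the summand \<open>q\<close>, which skips \<open>x\<close>.\<close>

lemma tensor_fun_Cons:
  assumes "length x = q"
  shows "tensor_fun (q # qs) (f # fs) (x @ y) = f x * tensor_fun qs fs y"
  unfolding tensor_fun_def list.size add_Suc_right add_0_right prod.lessThan_Suc_shift
  using assms by (simp add: add.commute)

lemma kron_list_diag_sampling_scalar:
  "kron_list (map (\<lambda>i. diag_sampling_scalar (n i) (a i)) is) =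
    diag_sampling_scalar (concat (map n is)) (tensor_fun (map (\<lambda>i. length (n i)) is) (map a is))"
proof (induction "is")
  case Nil
  \<comment> \<open>The empty multi-index has a range with one element and the empty product is 1,
    so the sampling matrix is the \<open>1 x 1\<close> identity.\<close>
  show ?case
    by (rule eq_matI) (auto simp: diag_sampling_scalar_def diag_sampling_def multi_range_def)
next
  case (Cons i "is")
  then show ?case
    by (simp add: diag_sampling_scalar_append tensor_fun_Cons)
qed

section \<open>Interleaving by \<Pi>\<close>

lemma interleaved_perm:
  "distinct (concat (map (\<lambda>k. [k, d + k]) [1..<Suc d]))"
  "set (concat (map (\<lambda>k. [k, d + k]) [1..<Suc d])) = {1..2 * d}"
proof -
  \<comment> \<open>Generalised from the full range to keep \<open>d\<close> fixed during the
    induction; the bound on \<open>ks\<close> keeps the entries \<open>k\<close> apart from the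
    entries \<open>d + k\<close>.\<close>
  have distinct: "distinct (concat (map (\<lambda>k. [k, d + k]) ks))" if "distinct ks" "set ks \<subseteq> {1..d}" for ks
    using that by (induction ks) auto
  show "distinct (concat (map (\<lambda>k. [k, d + k]) [1..<Suc d]))"
    by (rule distinct) auto
  have "x \<in> set [1..<Suc d] \<or> (\<exists>k\<in>set [1..<Suc d]. x = d + k)" if "x \<in> {1..2 * d}" for x
    using that by (cases "x \<le> d") (auto intro!: bexI[of _ "x - d"])
  then show "set (concat (map (\<lambda>k. [k, d + k]) [1..<Suc d])) = {1..2 * d}"
    by (fastforce simp del: upt_Suc)
qed

theorem Pi_mat_conj:
  assumes "\<And>i. i \<in> {1..d} \<Longrightarrow> X i \<in> carrier_mat (p i) (p i)"
    and "\<And>i. i \<in> {1..d} \<Longrightarrow> Y i \<in> carrier_mat (q i) (q i)"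
  defines "G \<equiv> Pi_mat (map p [1..<Suc d]) (map q [1..<Suc d])"
  shows "G * (kron_list (map X [1..<Suc d]) \<otimes>\<^sub>K kron_list (map Y [1..<Suc d])) * G\<^sup>T =
    kron_list (map (\<lambda>i. X i \<otimes>\<^sub>K Y i) [1..<Suc d])"
proof -
  let ?ks = "[1..<Suc d]"
  let ?\<sigma> = "concat (map (\<lambda>k. [k, d + k]) ?ks)" and ?Zs = "map X ?ks @ map Y ?ks"
  have G: "G = Gamma_mat (map p ?ks @ map q ?ks) ?\<sigma>"
    by (simp add: G_def Pi_mat_def Let_def del: upt_Suc)
  have "set ?\<sigma> = {1..length (map p ?ks @ map q ?ks)}"
    unfolding interleaved_perm(2) by simp
  moreover have "list_all2 (\<lambda>n Z. Z \<in> carrier_mat n n) (map p ?ks @ map q ?ks) ?Zs"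
    using assms(1,2)
    by (intro list_all2_appendI) (auto simp: list_all2_map1 list_all2_map2 list_all2_same simp del: upt_Suc)
  ultimately have "G * kron_list ?Zs * G\<^sup>T = kron_list (map (\<lambda>j. ?Zs ! (j - 1)) ?\<sigma>)"
    unfolding G by (intro Gamma_mat_conj(2) interleaved_perm(1))
  \<comment> \<open>Counting from 1, position \<open>k\<close> of \<open>?Zs\<close> holds
    \<open>X k\<close> and position \<open>d + k\<close> holds \<open>Y k\<close>.\<close>
  also have "map (\<lambda>j. ?Zs ! (j - 1)) ?\<sigma> = concat (map (\<lambda>k. [X k, Y k]) ?ks)"
    unfolding map_concat list.map_comp o_def
    by (intro arg_cong[of _ _ concat] map_cong refl)
      (auto simp: nth_append simp del: upt_Suc)
  also have "kron_list \<dots> = kron_list (map (\<lambda>k. X k \<otimes>\<^sub>K Y k) ?ks)"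
    by (simp add: kron_list_concat o_def del: upt_Suc)
  finally show ?thesis
    by (simp add: kron_list_append del: upt_Suc)
qed

theorem theorem7p1:
  fixes d :: nat and s :: "nat \<Rightarrow> nat" and n :: "nat \<Rightarrow> nat list"
    and a :: "nat \<Rightarrow> real list \<Rightarrow> complex"
  assumes "d \<ge> 1"
    and "\<And>i. i \<in> {1..d} \<Longrightarrow> s i \<ge> 1"
    and "\<And>i m. i \<in> {1..d} \<Longrightarrow> m \<in> set (n i) \<Longrightarrow> m \<ge> 1"
  shows
    "kron_list (map (\<lambda>i. diag_sampling (n i) (\<lambda>x. a i x \<cdot>\<^sub>m 1\<^sub>m (s i))) [1..<Suc d]) =
       Pi_mat (map (\<lambda>i. multi_size (n i)) [1..<Suc d]) (map s [1..<Suc d]) *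
       diag_sampling (concat (map n [1..<Suc d]))
         (\<lambda>x. tensor_fun (map (\<lambda>i. length (n i)) [1..<Suc d]) (map a [1..<Suc d]) x
               \<cdot>\<^sub>m 1\<^sub>m (\<Prod>i=1..d. s i)) *
       (Pi_mat (map (\<lambda>i. multi_size (n i)) [1..<Suc d]) (map s [1..<Suc d]))\<^sup>T
     \<and> ((\<forall>i\<in>{1..d}. s i = 1) \<longrightarrow>
         kron_list (map (\<lambda>i. diag_sampling_scalar (n i) (a i)) [1..<Suc d]) =
         diag_sampling_scalar (concat (map n [1..<Suc d]))
           (tensor_fun (map (\<lambda>i. length (n i)) [1..<Suc d]) (map a [1..<Suc d])))"
proof -
  let ?ks = "[1..<Suc d]"
  let ?D = "\<lambda>i. diag_sampling_scalar (n i) (a i)"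
  let ?G = "Pi_mat (map (\<lambda>i. multi_size (n i)) ?ks) (map s ?ks)"
  let ?n = "concat (map n ?ks)" and ?a = "tensor_fun (map (\<lambda>i. length (n i)) ?ks) (map a ?ks)"
  have prod: "(\<Prod>i=1..d. s i) = prod_list (map s ?ks)"
    using prod.distinct_set_conv_list[of ?ks s] by (simp add: atLeastLessThanSuc_atLeastAtMost del: upt_Suc One_nat_def)
  \<comment> \<open>Both parts are factored: the scalar sampling matrix along the multi-indices, the
    large identity along the \<open>s i\<close>. This is the input form of
    \<open>Pi_mat_conj\<close>.\<close>
  have "diag_sampling ?n (\<lambda>x. ?a x \<cdot>\<^sub>m 1\<^sub>m (\<Prod>i=1..d. s i)) =
      kron_list (map ?D ?ks) \<otimes>\<^sub>K kron_list (map (\<lambda>i. 1\<^sub>m (s i)) ?ks)"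
    using kron_list_one[of "map s ?ks"]
    by (simp add: diag_sampling_smult kron_list_diag_sampling_scalar prod o_def del: upt_Suc One_nat_def)
  moreover have "?G * \<dots> * ?G\<^sup>T = kron_list (map (\<lambda>i. ?D i \<otimes>\<^sub>K 1\<^sub>m (s i)) ?ks)"
    by (intro Pi_mat_conj diag_sampling_scalar_carrier one_carrier_mat)
  \<comment> \<open>On the left of the first identity \<open>diag_sampling_smult\<close> splits each
    factor; the scalar identity is \<open>kron_list_diag_sampling_scalar\<close>.\<close>
  ultimately show ?thesis
    by (simp only: diag_sampling_smult kron_list_diag_sampling_scalar simp_thms)
qed

end
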